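(* There is an absolute constant $C>0$ such that for every integer $d\ge2$ and every $\epsilon\in(0,1/2]$ there is a parallel-query algorithm (the high-dimensional version of gradient flow trapping) which, for every differentiable $f:[0,1]^d\to\mathbb{R}$ satisfying $\|\nabla f(x)-\nabla f(y)\|_2\le\|x-y\|_2$ for all $x,y\in[0,1]^d$, finds an $\epsilon$-stationary point of $f$ in depth at most $C\,d^2\log(d/\epsilon)$ and with total work at most $d^{Cd}\cdot\left(\frac{\log(1/\epsilon)}{\epsilon}\right)^{\frac{d-1}{2}}$.
   Context: Stationary point: a point $x\in[0,1]^d$ is an $\epsilon$-stationary point of $f$ if for every $\epsilon'>\epsilon$ there is a neighborhood $N\subset[0,1]^d$ of $x$ in $[0,1]^d$ such that $f(x)\le f(y)+\epsilon'\|x-y\|_2$ for all $y\in N$. In particular, for $x\in(0,1)^d$ this means $\|\nabla f(x)\|_2\le\epsilon$. Parallel query model (black box, zeroth order): the algorithm is deterministic, knows $d$ and $\epsilon$ but not $f$, and proceeds in rounds. In each round it submits a finite set of points of $[0,1]^d$, chosen as a function of the answers received in earlier rounds, and receives the exact values of $f$ at all of these points. At the end it outputs a point of $[0,1]^d$. The depth is the number of rounds, and the total work is the total number of queried points over all rounds; computation is otherwise free. *)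

theory Defs
  imports "HOL-Analysis.L2_Norm" "HOL-Library.FuncSet"
begin

(* The dimension d is quantified inside the theorem (the constant must not depend on it), so R^d is
   not a type here: a point is a function whose coordinates are its values at 0, ..., d - 1. *)
type_synonym point = "nat \<Rightarrow> real"

(* Points of the cube are extensional (undefined outside {..<d}), so each point of [0,1]^d has
   exactly one representative and set cardinalities count points correctly. *)
definition unit_cube :: "nat \<Rightarrow> point set" where
  "unit_cube d = {..<d} \<rightarrow>\<^sub>E {0..1}"

definition l2_dist :: "nat \<Rightarrow> point \<Rightarrow> point \<Rightarrow> real" where
  "l2_dist d x y = L2_set (\<lambda>i. x i - y i) {..<d}"

(* Frechet differentiability relative to the cube, boundary points included. *)
definition has_gradient :: "nat \<Rightarrow> (point \<Rightarrow> real) \<Rightarrow> point \<Rightarrow> point \<Rightarrow> bool" where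
  "has_gradient d f x v \<longleftrightarrow>
     (\<forall>e>0. \<exists>r>0. \<forall>y\<in>unit_cube d. l2_dist d x y < r \<longrightarrow>
        \<bar>f y - f x - (\<Sum>i<d. v i * (y i - x i))\<bar> \<le> e * l2_dist d x y)"

(* Gradients relative to the cube are unique in their first d coordinates, so the function g
   below is the gradient of f. *)
definition smooth_on_cube :: "nat \<Rightarrow> (point \<Rightarrow> real) \<Rightarrow> bool" where
  "smooth_on_cube d f \<longleftrightarrow>
     (\<exists>g. (\<forall>x\<in>unit_cube d. has_gradient d f x (g x)) \<and>
          (\<forall>x\<in>unit_cube d. \<forall>y\<in>unit_cube d. l2_dist d (g x) (g y) \<le> l2_dist d x y))"

definition cube_nbhd :: "nat \<Rightarrow> point \<Rightarrow> point set \<Rightarrow> bool" where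
  "cube_nbhd d x N \<longleftrightarrow>
     N \<subseteq> unit_cube d \<and> (\<exists>r>0. {y \<in> unit_cube d. l2_dist d x y < r} \<subseteq> N)"

definition stationary_point :: "nat \<Rightarrow> real \<Rightarrow> (point \<Rightarrow> real) \<Rightarrow> point \<Rightarrow> bool" where
  "stationary_point d \<epsilon> f x \<longleftrightarrow>
     x \<in> unit_cube d \<and>
     (\<forall>\<epsilon>'>\<epsilon>. \<exists>N. cube_nbhd d x N \<and> (\<forall>y\<in>N. f x \<le> f y + \<epsilon>' * l2_dist d x y))"

(* A deterministic parallel-query algorithm as a decision tree: either stop with an output, or
   submit a set of query points and continue with a subtree depending on the answers. All earlier
   answers are known in a subtree, since its choice depends on them. *)
datatype algorithm =
    Output point
  | Round "point set" "(point \<Rightarrow> real) \<Rightarrow> algorithm"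

primrec valid_algorithm :: "nat \<Rightarrow> algorithm \<Rightarrow> bool" where
  "valid_algorithm d (Output x) \<longleftrightarrow> x \<in> unit_cube d"
| "valid_algorithm d (Round Q k) \<longleftrightarrow>
     finite Q \<and> Q \<subseteq> unit_cube d \<and> (\<forall>a. valid_algorithm d (k a))"

(* In the runs below, the answers passed on are the restriction of f to the queried points, so
   nothing else about f is revealed. *)
primrec alg_output :: "(point \<Rightarrow> real) \<Rightarrow> algorithm \<Rightarrow> point" where
  "alg_output f (Output x) = x"
| "alg_output f (Round Q k) = alg_output f (k (restrict f Q))"

primrec alg_depth :: "(point \<Rightarrow> real) \<Rightarrow> algorithm \<Rightarrow> nat" where
  "alg_depth f (Output x) = 0"
| "alg_depth f (Round Q k) = Suc (alg_depth f (k (restrict f Q)))"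

primrec alg_work :: "(point \<Rightarrow> real) \<Rightarrow> algorithm \<Rightarrow> nat" where
  "alg_work f (Output x) = 0"
| "alg_work f (Round Q k) = card Q + alg_work f (k (restrict f Q))"

end

theory Submission
  imports Defs "HOL-Analysis.Function_Topology" "HOL-Analysis.Derivative"
begin

text \<open>
  The algorithm keeps a box \<open>R\<close> and a point \<open>x\<close> in it such that \<open>f z > f x - e * |x - z|\<close> for all
  \<open>z\<close> on the walls of \<open>R\<close>. A minimiser over \<open>R\<close> of \<open>F z = f z + e * |x - z|\<close> then avoids the walls, so
  it is an \<open>e\<close>-stationary point; no gradient flow is needed.

  To shrink \<open>R\<close> in direction \<open>i\<close>, query a grid on finitely many hyperplanes orthogonal to \<open>i\<close>, all at
  distance at least \<open>w\<close> from \<open>x\<close>, and let \<open>y\<close> minimise \<open>F\<close> over \<open>x\<close> and the grid. By the triangle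
  inequality \<open>y\<close> inherits the walls of \<open>x\<close>, and the hyperplanes around \<open>y\<close> become new walls, provided
  the discretisation error is below \<open>s * w\<close>, in which case \<open>e\<close> increases to \<open>e + s\<close>. Away from \<open>x\<close> the
  function \<open>F\<close> is smooth, so the error is quadratic in the grid spacing.

  With \<open>M\<close> of order \<open>ln (d / \<epsilon>)\<close> and \<open>s = \<epsilon> / (4 * d * M)\<close>, the rounds at side length \<open>r = (1/4)^m\<close>
  need about \<open>(d^3 * M * r / \<epsilon>) powr ((d - 1) / 2)\<close> queries each; these numbers decay geometrically in
  \<open>m\<close>, so the coarsest boxes dominate the work.
\<close>

section \<open>Functions with Lipschitz gradient on the cube\<close>

definition dot :: "nat \<Rightarrow> point \<Rightarrow> point \<Rightarrow> real" where
  "dot d a b = (\<Sum>i<d. a i * b i)"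

lemma abs_dot_le: "\<bar>dot d a b\<bar> \<le> L2_set a {..<d} * L2_set b {..<d}"
proof -
  have "\<bar>dot d a b\<bar> \<le> (\<Sum>i<d. \<bar>a i\<bar> * \<bar>b i\<bar>)"
    unfolding dot_def by (rule order_trans[OF sum_abs]) (simp add: abs_mult)
  also have "\<dots> \<le> L2_set a {..<d} * L2_set b {..<d}" by (rule L2_set_mult_ineq)
  finally show ?thesis .
qed

lemma l2_dist_nonneg [simp]: "0 \<le> l2_dist d x y"
  by (simp add: l2_dist_def)

lemma l2_dist_self [simp]: "l2_dist d x x = 0"
  by (simp add: l2_dist_def L2_set_0')

lemma l2_dist_triangle: "l2_dist d x z \<le> l2_dist d x y + l2_dist d y z"
  unfolding l2_dist_def
  using L2_set_triangle_ineq[of "\<lambda>i. x i - y i" "\<lambda>i. y i - z i" "{..<d}"] by simp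

lemma l2_dist_power2: "(l2_dist d x y)\<^sup>2 = (\<Sum>i<d. (x i - y i)\<^sup>2)"
  by (simp add: l2_dist_def L2_set_def sum_nonneg)

lemma L2_set_minus: "L2_set (\<lambda>i. y i - x i) {..<d} = l2_dist d x y"
  by (simp add: l2_dist_def L2_set_def power2_commute)

lemma abs_le_l2_dist: "i < d \<Longrightarrow> \<bar>x i - y i\<bar> \<le> l2_dist d x y"
proof -
  assume "i < d"
  then have "\<bar>x i - y i\<bar> \<le> L2_set (\<lambda>i. \<bar>x i - y i\<bar>) {..<d}"
    by (intro member_le_L2_set) auto
  then show ?thesis by (simp add: l2_dist_def L2_set_def)
qed

lemma l2_dist_le_bound:
  assumes "\<And>i. i < d \<Longrightarrow> \<bar>x i - y i\<bar> \<le> a"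
  shows "l2_dist d x y \<le> real d * a"
proof -
  have "l2_dist d x y \<le> (\<Sum>i<d. \<bar>x i - y i\<bar>)"
    unfolding l2_dist_def by (rule L2_set_le_sum_abs)
  also have "\<dots> \<le> (\<Sum>i<d. a)" using assms by (intro sum_mono) auto
  finally show ?thesis by simp
qed

lemma l2_dist_power2_le_bound:
  assumes "\<And>i. i < d \<Longrightarrow> \<bar>x i - y i\<bar> \<le> a"
  shows "(l2_dist d x y)\<^sup>2 \<le> real d * a\<^sup>2"
proof -
  have "(l2_dist d x y)\<^sup>2 \<le> (\<Sum>i<d. a\<^sup>2)"
    unfolding l2_dist_power2 using assms
    by (intro sum_mono) (metis abs_ge_zero lessThan_iff power2_abs power_mono)
  then show ?thesis by simp
qed

lemma continuous_on_l2_dist: "continuous_on S (\<lambda>y. l2_dist d x y)"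
  unfolding l2_dist_def L2_set_def
  by (intro continuous_intros continuous_on_subset[OF continuous_on_product_coordinates]) auto

definition seg :: "nat \<Rightarrow> point \<Rightarrow> point \<Rightarrow> real \<Rightarrow> point" where
  "seg d x v t = (\<lambda>i\<in>{..<d}. x i + t * v i)"

lemma l2_dist_seg: "l2_dist d (seg d x v s) (seg d x v t) = \<bar>s - t\<bar> * L2_set v {..<d}"
proof -
  have "l2_dist d (seg d x v s) (seg d x v t) = L2_set (\<lambda>i. \<bar>s - t\<bar> * v i) {..<d}"
    unfolding l2_dist_def L2_set_def
    by (intro arg_cong[of _ _ sqrt] sum.cong)
      (simp_all add: seg_def algebra_simps power2_eq_square)
  then show ?thesis by (simp add: L2_set_right_distrib)
qed

lemma l2_dist_seg0: "l2_dist d x (seg d x v t) = \<bar>t\<bar> * L2_set v {..<d}"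
  using l2_dist_seg[of d x v 0 t] by (simp add: l2_dist_def seg_def L2_set_def)

lemma seg_in_cube:
  assumes "x \<in> unit_cube d" "y \<in> unit_cube d" "0 \<le> t" "t \<le> 1"
  shows "seg d x (\<lambda>i. y i - x i) t \<in> unit_cube d"
proof -
  have "0 \<le> x i + t * (y i - x i) \<and> x i + t * (y i - x i) \<le> 1" if "i < d" for i
  proof -
    have *: "0 \<le> x i" "x i \<le> 1" "0 \<le> y i" "y i \<le> 1"
      using assms that by (auto simp: unit_cube_def PiE_iff)
    have "x i + t * (y i - x i) = (1 - t) * x i + t * y i" by (simp add: algebra_simps)
    moreover have "(1 - t) * x i \<le> (1 - t) * 1" "t * y i \<le> t * 1"
      using * assms mult_left_mono[of "x i" 1 "1 - t"] mult_left_mono[of "y i" 1 t] by auto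
    ultimately show ?thesis using * assms by auto
  qed
  then show ?thesis by (auto simp: unit_cube_def seg_def)
qed

section \<open>First-order calculus relative to the cube, boundary points included\<close>

locale smooth_function =
  fixes d :: nat and f :: "point \<Rightarrow> real" and g :: "point \<Rightarrow> point"
  assumes grad: "x \<in> unit_cube d \<Longrightarrow> has_gradient d f x (g x)"
    and lip: "x \<in> unit_cube d \<Longrightarrow> y \<in> unit_cube d \<Longrightarrow> l2_dist d (g x) (g y) \<le> l2_dist d x y"
begin

lemma grad_approx:
  assumes "x \<in> unit_cube d" "e > 0"
  obtains r where "r > 0" "\<And>y. y \<in> unit_cube d \<Longrightarrow> l2_dist d x y < r \<Longrightarrow>
        \<bar>f y - f x - dot d (g x) (\<lambda>i. y i - x i)\<bar> \<le> e * l2_dist d x y"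
  using grad[OF assms(1)] assms(2) unfolding has_gradient_def dot_def by meson

lemma dot_lip:
  assumes "x \<in> unit_cube d" "y \<in> unit_cube d"
  shows "\<bar>dot d (g x) v - dot d (g y) v\<bar> \<le> l2_dist d x y * L2_set v {..<d}"
proof -
  have "dot d (g x) v - dot d (g y) v = dot d (\<lambda>i. g x i - g y i) v"
    by (simp add: dot_def left_diff_distrib sum_subtractf)
  then have "\<bar>dot d (g x) v - dot d (g y) v\<bar> \<le> l2_dist d (g x) (g y) * L2_set v {..<d}"
    using abs_dot_le[of d "\<lambda>i. g x i - g y i" v] by (simp add: l2_dist_def)
  also have "\<dots> \<le> l2_dist d x y * L2_set v {..<d}"
    using lip[OF assms] by (simp add: mult_right_mono)
  finally show ?thesis .
qed

lemma mean_value: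
  assumes x: "x \<in> unit_cube d" and y: "y \<in> unit_cube d"
  obtains t where "0 \<le> t" "t \<le> 1"
    "f y - f x = dot d (g (seg d x (\<lambda>i. y i - x i) t)) (\<lambda>i. y i - x i)"
proof -
  let ?v = "\<lambda>i. y i - x i"
  let ?s = "seg d x ?v"
  let ?D = "\<lambda>t. dot d (g (?s t)) ?v"
  have der: "((\<lambda>t. f (?s t)) has_derivative (\<lambda>h. h * ?D t)) (at t within {0..1})"
    if t: "0 \<le> t" "t \<le> 1" for t
    unfolding has_derivative_within_alt
  proof (intro conjI allI impI)
    show "bounded_linear (\<lambda>h. h * ?D t)" by (rule bounded_linear_mult_left)
    fix e :: real assume e: "e > 0"
    define L where "L = L2_set ?v {..<d}"
    have L: "0 \<le> L" by (simp add: L_def)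
    have st: "?s t \<in> unit_cube d" using seg_in_cube[OF x y] t by blast
    \<comment> \<open>\<open>L + 1\<close> instead of \<open>L\<close> avoids a division by zero
      when \<open>x = y\<close>.\<close>
    have "e / (L + 1) > 0" using e L by simp
    from grad_approx[OF st this] obtain r where r: "r > 0"
      "\<And>z. z \<in> unit_cube d \<Longrightarrow> l2_dist d (?s t) z < r \<Longrightarrow>
        \<bar>f z - f (?s t) - dot d (g (?s t)) (\<lambda>i. z i - ?s t i)\<bar> \<le> e / (L + 1) * l2_dist d (?s t) z"
      by blast
    show "\<exists>r>0. \<forall>t'\<in>{0..1}. norm (t' - t) < r \<longrightarrow>
       norm (f (?s t') - f (?s t) - (t' - t) * ?D t) \<le> e * norm (t' - t)"
    proof (intro exI[of _ "r / (L + 1)"] conjI ballI impI)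
      show "r / (L + 1) > 0" using r L by simp
      fix t' :: real assume t': "t' \<in> {0..1}" "norm (t' - t) < r / (L + 1)"
      have st': "?s t' \<in> unit_cube d" using seg_in_cube[OF x y] t' by auto
      have dist: "l2_dist d (?s t) (?s t') = \<bar>t' - t\<bar> * L"
        by (simp add: l2_dist_seg L_def abs_minus_commute)
      have "\<bar>t' - t\<bar> * L \<le> \<bar>t' - t\<bar> * (L + 1)" by (simp add: mult_left_mono)
      also have "\<dots> < r" using t' L by (simp add: pos_less_divide_eq)
      finally have "l2_dist d (?s t) (?s t') < r" using dist by simp
      from r(2)[OF st' this]
      have A: "\<bar>f (?s t') - f (?s t) - dot d (g (?s t)) (\<lambda>i. ?s t' i - ?s t i)\<bar>
          \<le> e / (L + 1) * (\<bar>t' - t\<bar> * L)" using dist by simp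
      have "dot d (g (?s t)) (\<lambda>i. ?s t' i - ?s t i) = (t' - t) * ?D t"
        unfolding dot_def sum_distrib_left
        by (rule sum.cong) (simp_all add: seg_def algebra_simps)
      moreover have "e / (L + 1) * (\<bar>t' - t\<bar> * L) = e * \<bar>t' - t\<bar> * (L / (L + 1))" by simp
      moreover have "\<dots> \<le> e * \<bar>t' - t\<bar> * 1"
        by (rule mult_left_mono) (use L e in \<open>auto simp: field_simps\<close>)
      ultimately show "norm (f (?s t') - f (?s t) - (t' - t) * ?D t) \<le> e * norm (t' - t)"
        using A by simp
    qed
  qed
  obtain t where "t \<in> {0..1}" "f (?s 1) - f (?s 0) = (1 - 0) * ?D t"
    using mvt_very_simple[of 0 1 "\<lambda>t. f (?s t)" "\<lambda>t h. h * ?D t"] der by auto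
  \<comment> \<open>The endpoints agree as functions, beyond the first \<open>d\<close> coordinates
    too, because cube points are extensional.\<close>
  moreover have "?s 1 = y" "?s 0 = x"
    using x y by (auto simp: seg_def unit_cube_def PiE_iff extensional_def)
  ultimately show ?thesis using that by auto
qed

text \<open>Mean value theorem, then Cauchy-Schwarz on the change of gradient, which is at most the
  distance travelled. Bounding that distance by the full length gives the coefficient 1 in place of
  the sharp 1/2.\<close>

lemma upper_bound:
  assumes x: "x \<in> unit_cube d" and y: "y \<in> unit_cube d"
  shows "f y \<le> f x + dot d (g x) (\<lambda>i. y i - x i) + (l2_dist d x y)\<^sup>2"
proof -
  let ?v = "\<lambda>i. y i - x i"
  obtain t where t: "0 \<le> t" "t \<le> 1" "f y - f x = dot d (g (seg d x ?v t)) ?v"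
    using mean_value[OF x y] by blast
  have "\<bar>dot d (g x) ?v - dot d (g (seg d x ?v t)) ?v\<bar>
      \<le> l2_dist d x (seg d x ?v t) * L2_set ?v {..<d}"
    by (rule dot_lip[OF x seg_in_cube[OF x y t(1,2)]])
  also have "\<dots> = t * (l2_dist d x y)\<^sup>2"
    using t by (simp add: l2_dist_seg0 L2_set_minus power2_eq_square)
  also have "\<dots> \<le> 1 * (l2_dist d x y)\<^sup>2" using t by (intro mult_right_mono) auto
  finally show ?thesis using t(3) by simp
qed

text \<open>Used to attain minima on boxes. Continuity refers to the product topology on functions;
  there \<open>l2_dist\<close> is continuous, and the first-order expansion bounds the change of
  \<open>f\<close> by a multiple of it.\<close>

lemma continuous_on_cube: "continuous_on (unit_cube d) f"
  unfolding continuous_on_def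
proof
  fix x assume x: "x \<in> unit_cube d"
  obtain r where r: "r > 0" "\<And>y. y \<in> unit_cube d \<Longrightarrow> l2_dist d x y < r \<Longrightarrow>
        \<bar>f y - f x - dot d (g x) (\<lambda>i. y i - x i)\<bar> \<le> 1 * l2_dist d x y"
    using grad_approx[OF x, of 1] by auto
  have lim: "((\<lambda>y. l2_dist d x y) \<longlongrightarrow> 0) (at x within unit_cube d)"
    using continuous_on_l2_dist[of "unit_cube d" d x] x unfolding continuous_on_def by fastforce
  have "((\<lambda>y. f y - f x) \<longlongrightarrow> 0) (at x within unit_cube d)"
  proof (rule Lim_null_comparison)
    show "((\<lambda>y. (L2_set (g x) {..<d} + 1) * l2_dist d x y) \<longlongrightarrow> 0) (at x within unit_cube d)"
      using tendsto_mult_right_zero[OF lim] by simp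
    have "\<forall>\<^sub>F y in at x within unit_cube d. y \<in> unit_cube d"
      by (simp add: eventually_at_filter)
    moreover have "\<forall>\<^sub>F y in at x within unit_cube d. l2_dist d x y < r"
      using order_tendstoD(2)[OF lim r(1)] .
    ultimately show "\<forall>\<^sub>F y in at x within unit_cube d.
        norm (f y - f x) \<le> (L2_set (g x) {..<d} + 1) * l2_dist d x y"
    proof eventually_elim
      case (elim y)
      have "\<bar>dot d (g x) (\<lambda>i. y i - x i)\<bar> \<le> L2_set (g x) {..<d} * l2_dist d x y"
        using abs_dot_le[of d "g x" "\<lambda>i. y i - x i"] by (simp add: L2_set_minus)
      then show ?case using r(2)[OF elim] by (simp add: algebra_simps)
    qed
  qed
  then show "(f \<longlongrightarrow> f x) (at x within unit_cube d)" by (simp add: LIM_zero_iff)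
qed

text \<open>First-order condition at a local minimiser \<open>p\<close> of
  \<open>f z + e * l2_dist d p z\<close>: take a small step \<open>t\<close> along a feasible
  direction and divide by \<open>t\<close>; \<open>\<eta>\<close> absorbs the differentiation
  error.\<close>

lemma directional_bound:
  assumes p: "p \<in> unit_cube d"
    and seg: "t0 > 0" "\<And>t. 0 \<le> t \<Longrightarrow> t \<le> t0 \<Longrightarrow> seg d p v t \<in> unit_cube d"
    and loc: "r0 > 0" "\<And>z. z \<in> unit_cube d \<Longrightarrow> l2_dist d p z < r0 \<Longrightarrow> f p \<le> f z + e * l2_dist d p z"
  shows "- e * L2_set v {..<d} \<le> dot d (g p) v"
proof (rule field_le_epsilon)
  fix \<eta> :: real assume \<eta>: "\<eta> > 0"
  define L where "L = L2_set v {..<d}"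
  have L: "0 \<le> L" by (simp add: L_def)
  have "\<eta> / (L + 1) > 0" using \<eta> L by simp
  from grad_approx[OF p this] obtain r where r: "r > 0"
    "\<And>z. z \<in> unit_cube d \<Longrightarrow> l2_dist d p z < r \<Longrightarrow>
        \<bar>f z - f p - dot d (g p) (\<lambda>i. z i - p i)\<bar> \<le> \<eta> / (L + 1) * l2_dist d p z"
    by blast
  define t where "t = min t0 (min (r0 / (2 * (L + 1))) (r / (2 * (L + 1))))"
  have t: "t > 0" "t \<le> t0" "t \<le> r0 / (2 * (L + 1))" "t \<le> r / (2 * (L + 1))"
    using seg(1) loc(1) r(1) L by (auto simp: t_def)
  define z where "z = seg d p v t"
  have z: "z \<in> unit_cube d" using seg(2) t by (simp add: z_def)
  have dist: "l2_dist d p z = t * L" using t by (simp add: z_def l2_dist_seg0 L_def)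
  have "t * L \<le> t * (L + 1)" using t by simp
  moreover have "t * (L + 1) \<le> r0 / 2" "t * (L + 1) \<le> r / 2"
    using t L by (simp_all add: field_simps)
  ultimately have lt: "l2_dist d p z < r0" "l2_dist d p z < r"
    using dist loc(1) r(1) by linarith+
  have "dot d (g p) (\<lambda>i. z i - p i) = t * dot d (g p) v"
    unfolding dot_def sum_distrib_left
    by (rule sum.cong) (simp_all add: z_def seg_def algebra_simps)
  then have "- e * (t * L) - \<eta> / (L + 1) * (t * L) \<le> t * dot d (g p) v"
    using r(2)[OF z lt(2)] loc(2)[OF z lt(1)] dist by simp
  then have "t * (- e * L - \<eta> / (L + 1) * L) \<le> t * dot d (g p) v"
    by (simp add: algebra_simps)
  then have "- e * L - \<eta> / (L + 1) * L \<le> dot d (g p) v"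
    using t(1) by simp
  moreover have "\<eta> / (L + 1) * L \<le> \<eta>" using \<eta> L by (simp add: field_simps)
  ultimately show "- e * L2_set v {..<d} \<le> dot d (g p) v + \<eta>" by (simp add: L_def)
qed

lemma stationary_pointI:
  assumes x: "x \<in> unit_cube d"
    and dir: "\<And>y. y \<in> unit_cube d \<Longrightarrow> - e * l2_dist d x y \<le> dot d (g x) (\<lambda>i. y i - x i)"
  shows "stationary_point d e f x"
  unfolding stationary_point_def
proof (intro conjI allI impI x)
  fix e' assume "e < e'"
  then have "e' - e > 0" by simp
  from grad_approx[OF x this] obtain r where r: "r > 0"
    "\<And>y. y \<in> unit_cube d \<Longrightarrow> l2_dist d x y < r \<Longrightarrow>
        \<bar>f y - f x - dot d (g x) (\<lambda>i. y i - x i)\<bar> \<le> (e' - e) * l2_dist d x y"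
    by blast
  show "\<exists>N. cube_nbhd d x N \<and> (\<forall>y\<in>N. f x \<le> f y + e' * l2_dist d x y)"
  proof (intro exI[of _ "{y \<in> unit_cube d. l2_dist d x y < r}"] conjI ballI)
    show "cube_nbhd d x {y \<in> unit_cube d. l2_dist d x y < r}"
      using r(1) by (auto simp: cube_nbhd_def)
    fix y assume "y \<in> {y \<in> unit_cube d. l2_dist d x y < r}"
    then have y: "y \<in> unit_cube d" "l2_dist d x y < r" by auto
    show "f x \<le> f y + e' * l2_dist d x y"
      using r(2)[OF y] dir[OF y(1)] by (simp add: algebra_simps)
  qed
qed

end

section \<open>Traps and their refinement\<close>

definition mesh :: "nat \<Rightarrow> real \<Rightarrow> real \<Rightarrow> real set" where
  "mesh n a b = (\<lambda>k. a + (b - a) * real k / real n) ` {..n}"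

lemma mesh_bracket:
  assumes "n > 0" "a \<le> z" "z \<le> b"
  obtains p q where "p \<in> mesh n a b" "q \<in> mesh n a b" "p \<le> z" "z \<le> q" "q - p \<le> (b - a) / real n"
proof (cases "a = b")
  case True
  then have "a \<in> mesh n a b" by (auto simp: mesh_def intro!: image_eqI[of _ _ 0])
  then show ?thesis using that[of a a] True assms by simp
next
  case False
  then have ab: "a < b" using assms by simp
  define s where "s = (z - a) / (b - a) * real n"
  have z: "z = a + (b - a) * s / real n" using ab assms(1) by (simp add: s_def)
  have "(z - a) / (b - a) \<le> 1" using ab assms by simp
  then have s: "0 \<le> s" "s \<le> real n"
    using ab assms mult_right_mono[of "(z - a) / (b - a)" 1 "real n"] by (auto simp: s_def)
  define p where "p = a + (b - a) * real (nat \<lfloor>s\<rfloor>) / real n"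
  define q where "q = a + (b - a) * real (nat \<lceil>s\<rceil>) / real n"
  have fl: "real (nat \<lfloor>s\<rfloor>) \<le> s" "s \<le> real (nat \<lceil>s\<rceil>)" "real (nat \<lceil>s\<rceil>) - real (nat \<lfloor>s\<rfloor>) \<le> 1"
    using s ceiling_diff_floor_le_1[of s] by linarith+
  have n: "nat \<lfloor>s\<rfloor> \<le> n" "nat \<lceil>s\<rceil> \<le> n" using s by linarith+
  have "p \<in> mesh n a b" "q \<in> mesh n a b" using n by (auto simp: mesh_def p_def q_def)
  moreover have "p \<le> z" "z \<le> q"
    unfolding z p_def q_def using fl ab by (auto intro!: divide_right_mono mult_left_mono)
  moreover have "q - p \<le> (b - a) / real n"
  proof -
    have "q - p = (b - a) * (real (nat \<lceil>s\<rceil>) - real (nat \<lfloor>s\<rfloor>)) / real n"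
      by (simp add: p_def q_def diff_divide_distrib right_diff_distrib)
    also have "\<dots> \<le> (b - a) * 1 / real n"
      using fl ab by (intro divide_right_mono mult_left_mono) auto
    finally show ?thesis by simp
  qed
  ultimately show ?thesis by (rule that)
qed

lemma mesh_subset: "a \<le> b \<Longrightarrow> mesh n a b \<subseteq> {a..b}"
proof
  fix z assume ab: "a \<le> b" and "z \<in> mesh n a b"
  then obtain k where k: "k \<le> n" "z = a + (b - a) * real k / real n" by (auto simp: mesh_def)
  have "(b - a) * (real k / real n) \<le> (b - a) * 1"
    by (rule mult_left_mono) (use k ab in \<open>auto simp: divide_le_eq\<close>)
  then show "z \<in> {a..b}" using k ab by simp
qed

lemma card_mesh: "finite (mesh n a b)" "card (mesh n a b) \<le> n + 1"
  using card_image_le[of "{..n}" "\<lambda>k. a + (b - a) * real k / real n"] by (auto simp: mesh_def)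

text \<open>
  Only odd multiples of \<open>w\<close> are used, so that every cut is at distance at least \<open>w\<close> from \<open>c\<close>, and
  moving from one cut by \<open>2 * w\<close> leads to another cut and never back to \<open>c\<close>.
\<close>

definition cuts :: "real \<Rightarrow> real \<Rightarrow> real \<Rightarrow> real \<Rightarrow> real set" where
  "cuts w a b c = {s. a < s \<and> s < b \<and> (\<exists>k\<in>{-16..16::int}. odd k \<and> s = c + of_int k * w)}"

lemma card_cuts: "finite (cuts w a b c)" "card (cuts w a b c) \<le> 33"
proof -
  let ?S = "(\<lambda>k::int. c + of_int k * w) ` {-16..16}"
  have sub: "cuts w a b c \<subseteq> ?S" by (auto simp: cuts_def)
  then show "finite (cuts w a b c)" by (rule finite_subset) simp
  have "card (cuts w a b c) \<le> card ?S" by (rule card_mono[OF _ sub]) simp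
  also have "\<dots> \<le> card {-16..16::int}" by (rule card_image_le) simp
  finally show "card (cuts w a b c) \<le> 33" by simp
qed

text \<open>A box side of at most \<open>16 * w\<close> forces \<open>k\<close> into the index range
  of \<open>cuts\<close>, so the truncation there loses no odd multiple.\<close>

lemma cutsI:
  assumes "a < s" "s < b" "s = c + of_int k * w" "odd k" "w > 0" "a \<le> c" "c \<le> b" "b - a \<le> 16 * w"
  shows "s \<in> cuts w a b c"
proof -
  have "\<bar>of_int k * w\<bar> \<le> 16 * w" using assms by linarith
  then have "\<bar>of_int k :: real\<bar> \<le> 16" using assms(5) by (simp add: abs_mult)
  then have "k \<in> {-16..16}" by auto
  then show ?thesis using assms by (auto simp: cuts_def)
qed

lemma cuts_dist:
  assumes "s \<in> cuts w a b c" "w > 0"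
  shows "w \<le> \<bar>c - s\<bar>"
proof -
  obtain k :: int where k: "odd k" "s = c + of_int k * w" using assms by (auto simp: cuts_def)
  then have "1 \<le> \<bar>k\<bar>" by (cases "k = 0") auto
  then have "1 \<le> \<bar>of_int k :: real\<bar>" by linarith
  then have "1 * w \<le> \<bar>of_int k\<bar> * w" using assms by (intro mult_right_mono) auto
  then show ?thesis using k assms by (simp add: abs_mult)
qed

text \<open>Coordinate \<open>i\<close> takes the exact cut positions, so a point on a cut is
  rounded only in the other coordinates.\<close>

definition net :: "nat \<Rightarrow> nat \<Rightarrow> nat \<Rightarrow> real \<Rightarrow> point \<Rightarrow> point \<Rightarrow> point \<Rightarrow> point set" where
  "net d i n w x l u =
     (\<Pi>\<^sub>E j\<in>{..<d}. if j = i then cuts w (l i) (u i) (x i) else mesh n (l j) (u j))"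

lemma finite_net: "finite (net d i n w x l u)"
  by (auto simp: net_def card_cuts card_mesh intro!: finite_PiE)

lemma card_net:
  assumes "i < d"
  shows "card (net d i n w x l u) \<le> 33 * (n + 1) ^ (d - 1)"
proof -
  have "card (net d i n w x l u) =
      card (cuts w (l i) (u i) (x i)) * (\<Prod>j\<in>{..<d} - {i}. card (mesh n (l j) (u j)))"
    unfolding net_def using assms by (subst card_PiE) (auto simp: prod.remove[of _ i])
  also have "\<dots> \<le> 33 * (\<Prod>j\<in>{..<d} - {i}. n + 1)"
    by (intro mult_mono prod_mono) (auto simp: card_cuts card_mesh(2)[simplified])
  also have "(\<Prod>j\<in>{..<d} - {i}. n + 1) = (n + 1) ^ (d - 1)"
    using assms by simp
  finally show ?thesis .
qed

section \<open>Boxes, walls, traps and the update of a box\<close>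

definition box :: "nat \<Rightarrow> point \<Rightarrow> point \<Rightarrow> point set" where
  "box d l u = {z \<in> unit_cube d. \<forall>i<d. l i \<le> z i \<and> z i \<le> u i}"

text \<open>Faces of the box on the boundary of the cube are not walls: nothing can leave through them.\<close>

definition wall :: "nat \<Rightarrow> point \<Rightarrow> point \<Rightarrow> point set" where
  "wall d l u = {z \<in> box d l u. \<exists>i<d. z i = l i \<and> l i > 0 \<or> z i = u i \<and> u i < 1}"

lemma wallI:
  "z \<in> box d l u \<Longrightarrow> i < d \<Longrightarrow> z i = l i \<and> l i > 0 \<or> z i = u i \<and> u i < 1 \<Longrightarrow> z \<in> wall d l u"
  unfolding wall_def by blast

lemma wall_subset_box: "wall d l u \<subseteq> box d l u"
  by (auto simp: wall_def)

definition pointed_box :: "nat \<Rightarrow> point \<Rightarrow> point \<Rightarrow> point \<Rightarrow> bool" where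
  "pointed_box d x l u \<longleftrightarrow> x \<in> box d l u \<and> (\<forall>i<d. 0 \<le> l i \<and> u i \<le> 1)"

definition trap :: "nat \<Rightarrow> (point \<Rightarrow> real) \<Rightarrow> real \<Rightarrow> point \<Rightarrow> point \<Rightarrow> point \<Rightarrow> bool" where
  "trap d f e x l u \<longleftrightarrow> pointed_box d x l u \<and> (\<forall>z\<in>wall d l u. f x < f z + e * l2_dist d x z)"

text \<open>The penalty is measured from the old point \<open>x\<close>. The answers
  \<open>a\<close> are a parameter, so that the algorithm can use the restricted answers and the
  analysis \<open>f\<close> itself.\<close>

definition best :: "nat \<Rightarrow> real \<Rightarrow> (point \<Rightarrow> real) \<Rightarrow> point \<Rightarrow> point set \<Rightarrow> point" where
  "best d e a x Q = arg_min_on (\<lambda>v. a v + e * l2_dist d x v) Q"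

lemma best:
  assumes "finite Q" "Q \<noteq> {}"
  shows "best d e a x Q \<in> Q"
    and "v \<in> Q \<Longrightarrow> a (best d e a x Q) + e * l2_dist d x (best d e a x Q) \<le> a v + e * l2_dist d x v"
  using arg_min_if_finite[OF assms, of "\<lambda>v. a v + e * l2_dist d x v"]
  by (auto simp: best_def not_less)

text \<open>Distance from the new point to the next cut position on either side: \<open>x\<close>
  lies midway between the multiples -1 and 1 of \<open>w\<close>, any other candidate on an odd
  multiple. In both cases the new side is at most \<open>4 * w\<close>.\<close>

definition margin :: "real \<Rightarrow> point \<Rightarrow> point \<Rightarrow> real" where
  "margin w x y = (if y = x then w else 2 * w)"

definition lower :: "nat \<Rightarrow> real \<Rightarrow> point \<Rightarrow> point \<Rightarrow> point" where
  "lower i h y l = l(i := max (l i) (y i - h))"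

definition upper :: "nat \<Rightarrow> real \<Rightarrow> point \<Rightarrow> point \<Rightarrow> point" where
  "upper i h y u = u(i := min (u i) (y i + h))"

lemma net_subset_box:
  assumes "pointed_box d x l u"
  shows "insert x (net d i n w x l u) \<subseteq> box d l u"
proof -
  have "v \<in> box d l u" if v: "v \<in> net d i n w x l u" for v
  proof -
    have "l j \<le> v j \<and> v j \<le> u j \<and> 0 \<le> l j \<and> u j \<le> 1" if "j < d" for j
    proof (cases "j = i")
      case True
      have "v j \<in> (if j = i then cuts w (l i) (u i) (x i) else mesh n (l j) (u j))"
        using PiE_mem[OF v[unfolded net_def], of j] that by simp
      then show ?thesis using True assms that by (auto simp: cuts_def pointed_box_def)
    next
      case False
      have "v j \<in> (if j = i then cuts w (l i) (u i) (x i) else mesh n (l j) (u j))"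
        using PiE_mem[OF v[unfolded net_def], of j] that by simp
      moreover have "l j \<le> x j" "x j \<le> u j" using assms that by (auto simp: pointed_box_def box_def)
      then have "mesh n (l j) (u j) \<subseteq> {l j..u j}" by (intro mesh_subset) simp
      ultimately show ?thesis using False assms that by (auto simp: pointed_box_def)
    qed
    moreover have "v \<in> extensional {..<d}" using v by (auto simp: net_def PiE_def)
    ultimately show ?thesis by (fastforce simp: box_def unit_cube_def PiE_iff)
  qed
  then show ?thesis using assms by (auto simp: pointed_box_def)
qed

lemma box_step_subset: "box d (lower i h y l) (upper i h y u) \<subseteq> box d l u"
proof
  fix z assume z: "z \<in> box d (lower i h y l) (upper i h y u)"
  have "l j \<le> z j \<and> z j \<le> u j" if "j < d" for j
  proof -
    have "l j \<le> lower i h y l j" "upper i h y u j \<le> u j" by (auto simp: lower_def upper_def)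
    moreover have "lower i h y l j \<le> z j" "z j \<le> upper i h y u j" using z that by (auto simp: box_def)
    ultimately show ?thesis by linarith
  qed
  then show "z \<in> box d l u" using z by (simp add: box_def)
qed

lemma pointed_box_step:
  assumes "pointed_box d x l u" "y \<in> box d l u" "h > 0"
  shows "pointed_box d y (lower i h y l) (upper i h y u)"
  using assms by (auto simp: pointed_box_def box_def lower_def upper_def)

lemma finite_family_lower_bound:
  fixes c :: "nat \<Rightarrow> real"
  assumes "\<And>i. i < d \<Longrightarrow> c i > 0"
  obtains r where "r > 0" "\<And>i. i < d \<Longrightarrow> r \<le> c i"
proof
  show "Min (insert 1 (c ` {..<d})) > 0" using assms by auto
  show "Min (insert 1 (c ` {..<d})) \<le> c i" if "i < d" for i
    using that by (intro Min_le) auto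
qed

text \<open>Tychonoff: coordinates from \<open>d\<close> on are confined to the singleton of
  \<open>undefined\<close>, which makes the box a product of compact sets over all indices.\<close>

lemma compact_box: "compact (box d l u)"
proof -
  let ?B = "\<lambda>i. if i < d then {max 0 (l i)..min 1 (u i)} else {undefined :: real}"
  have "box d l u = (\<Pi>\<^sub>E i\<in>UNIV. ?B i)"
  proof (intro set_eqI iffI)
    fix z assume "z \<in> box d l u"
    then show "z \<in> (\<Pi>\<^sub>E i\<in>UNIV. ?B i)"
      by (auto simp: box_def unit_cube_def PiE_iff extensional_def)
  next
    fix z assume "z \<in> (\<Pi>\<^sub>E i\<in>UNIV. ?B i)"
    then have "z i \<in> ?B i" for i by blast
    then have "i < d \<Longrightarrow> z i \<in> {max 0 (l i)..min 1 (u i)}" "\<not> i < d \<Longrightarrow> z i = undefined" for i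
      by (metis, metis singletonD)
    then show "z \<in> box d l u"
      by (auto simp: box_def unit_cube_def PiE_iff extensional_def)
  qed
  moreover have "compactin euclidean (\<Pi>\<^sub>E i\<in>UNIV. ?B i)"
    unfolding euclidean_product_topology[symmetric] compactin_PiE by auto
  ultimately show ?thesis by simp
qed

context smooth_function
begin

text \<open>
  Moving from \<open>z\<close> inside its cell to the vertex against the gradient of
  \<open>v \<mapsto> f v + e * |x - v|\<close> leaves only a second-order error.
\<close>

lemma net_approx:
  assumes P: "pointed_box d x l u" and z: "z \<in> box d l u" and i: "i < d"
    and cut: "z i \<in> cuts w (l i) (u i) (x i)"
    and n: "n > 0" and e: "0 \<le> e"
    and width: "\<And>j. j < d \<Longrightarrow> u j - l j \<le> r"
    and D: "0 < l2_dist d x z"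
  obtains v where "v \<in> net d i n w x l u"
    "f v + e * l2_dist d x v \<le>
       f z + e * l2_dist d x z + real d * (r / real n)\<^sup>2 * (1 + e / (2 * l2_dist d x z))"
proof -
  define D where "D = l2_dist d x z"
  \<comment> \<open>The gradient at \<open>z\<close> of \<open>f\<close> plus \<open>e\<close> times
    the distance from \<open>x\<close>, defined since \<open>D > 0\<close>.\<close>
  define c where "c j = g z j + e * (z j - x j) / D" for j
  have zb: "l j \<le> z j \<and> z j \<le> u j" if "j < d" for j using z that by (auto simp: box_def)
  have zc: "z \<in> unit_cube d" using z by (auto simp: box_def)
  have "\<exists>t. t \<in> mesh n (l j) (u j) \<and> c j * (t - z j) \<le> 0 \<and> \<bar>t - z j\<bar> \<le> r / real n"
    if j: "j < d" for j
  proof -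
    obtain p q where pq: "p \<in> mesh n (l j) (u j)" "q \<in> mesh n (l j) (u j)" "p \<le> z j" "z j \<le> q"
        "q - p \<le> (u j - l j) / real n"
      using mesh_bracket[OF n, of "l j" "z j" "u j"] zb[OF j] by blast
    have "(u j - l j) / real n \<le> r / real n" using width[OF j] by (intro divide_right_mono) auto
    then have "\<bar>p - z j\<bar> \<le> r / real n" "\<bar>q - z j\<bar> \<le> r / real n" using pq by auto
    then show ?thesis using pq by (cases "c j \<le> 0") (auto simp: mult_le_0_iff)
  qed
  then obtain V where V: "\<And>j. j < d \<Longrightarrow>
      V j \<in> mesh n (l j) (u j) \<and> c j * (V j - z j) \<le> 0 \<and> \<bar>V j - z j\<bar> \<le> r / real n"
    by metis
  define v where "v = (\<lambda>j\<in>{..<d}. if j = i then z i else V j)"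
  have v: "v \<in> net d i n w x l u" using V cut by (auto simp: net_def v_def)
  then have vc: "v \<in> unit_cube d"
    using net_subset_box[OF P, of i n w] unfolding box_def by blast
  have "0 \<le> r / real n" using V[OF i] by linarith
  then have vz: "c j * (v j - z j) \<le> 0" "\<bar>z j - v j\<bar> \<le> r / real n" if "j < d" for j
    using V[OF that] that by (auto simp: v_def)
  define q where "q = (l2_dist d z v)\<^sup>2"
  define B where "B = dot d (\<lambda>j. z j - x j) (\<lambda>j. v j - z j)"
  have q: "0 \<le> q" "q \<le> real d * (r / real n)\<^sup>2"
    using vz by (auto simp: q_def intro!: l2_dist_power2_le_bound)
  have "(l2_dist d x v)\<^sup>2 = D\<^sup>2 + 2 * B + q"
    unfolding D_def q_def l2_dist_power2 B_def dot_def sum_distrib_left sum.distrib[symmetric]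
    by (rule sum.cong) (simp_all add: power2_eq_square algebra_simps)
  \<comment> \<open>Expanding this square bounds \<open>l2_dist d x v\<close> by its linearisation
    at \<open>z\<close> plus \<open>q / (2 * D)\<close>.\<close>
  moreover have "0 \<le> (l2_dist d x v - D)\<^sup>2" by simp
  ultimately have "2 * D * l2_dist d x v \<le> 2 * D\<^sup>2 + 2 * B + q"
    by (simp add: power2_diff algebra_simps)
  then have lin: "l2_dist d x v \<le> D + B / D + q / (2 * D)"
    using D by (simp add: D_def[symmetric] field_simps power2_eq_square)
  have "dot d (g z) (\<lambda>j. v j - z j) + e * (B / D) = (\<Sum>j<d. c j * (v j - z j))"
    unfolding dot_def B_def c_def sum_distrib_left sum_divide_distrib sum.distrib[symmetric]
    by (rule sum.cong) (simp_all add: algebra_simps)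
  also have "\<dots> \<le> 0" using vz by (intro sum_nonpos) auto
  finally have neg: "dot d (g z) (\<lambda>j. v j - z j) + e * (B / D) \<le> 0" .
  have "f v \<le> f z + dot d (g z) (\<lambda>j. v j - z j) + q"
    unfolding q_def by (rule upper_bound[OF zc vc])
  moreover have "e * l2_dist d x v \<le> e * (D + B / D + q / (2 * D))"
    by (rule mult_left_mono[OF lin e])
  then have "e * l2_dist d x v \<le> e * D + e * (B / D) + q * (e / (2 * D))"
    by (simp add: algebra_simps)
  ultimately have "f v + e * l2_dist d x v \<le> f z + e * D + q * (1 + e / (2 * D))"
    using neg by (simp add: algebra_simps)
  also have "\<dots> \<le> f z + e * D + real d * (r / real n)\<^sup>2 * (1 + e / (2 * D))"
    using q D e by (intro add_left_mono mult_right_mono) (auto simp: D_def)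
  finally show ?thesis using that[OF v] by (simp add: D_def)
qed

lemma trap_step:
  assumes T: "trap d f e x l u" and i: "i < d" and n: "n > 0" and e: "0 \<le> e" and w: "w > 0"
    and width: "\<And>j. j < d \<Longrightarrow> u j - l j \<le> 16 * w"
    and err: "real d * (16 * w / real n)\<^sup>2 * (1 + e / (2 * w)) < s * w"
    and y: "y = best d e f x (insert x (net d i n w x l u))" and h: "h = margin w x y"
  shows "trap d f (e + s) y (lower i h y l) (upper i h y u)"
proof -
  let ?Q = "insert x (net d i n w x l u)"
  have P: "pointed_box d x l u" using T by (simp add: trap_def)
  have fin: "finite ?Q" "?Q \<noteq> {}" by (auto simp: finite_net)
  have yQ: "y \<in> ?Q" unfolding y by (rule best(1)[OF fin])
  have y_min: "f y + e * l2_dist d x y \<le> f v + e * l2_dist d x v" if "v \<in> ?Q" for v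
    unfolding y by (rule best(2)[OF fin that])
  have yb: "y \<in> box d l u" using yQ net_subset_box[OF P] by blast
  have xb: "x \<in> box d l u" using P by (simp add: pointed_box_def)
  have h0: "w \<le> h" using w by (simp add: h margin_def)
  \<comment> \<open>The strict error bound has a nonnegative left side, so it already forces
    \<open>s > 0\<close>.\<close>
  have "0 \<le> real d * (16 * w / real n)\<^sup>2 * (1 + e / (2 * w))"
    using e w by (intro mult_nonneg_nonneg add_nonneg_nonneg) auto
  then have "0 < s * w" using err by linarith
  then have s: "0 < s" using w by (simp add: zero_less_mult_iff)
  have tri: "l2_dist d x z \<le> l2_dist d x y + l2_dist d y z" for z by (rule l2_dist_triangle)
  \<comment> \<open>On old walls, \<open>y\<close> has at most the penalised value of
    \<open>x\<close>, and the triangle inequality moves the reference point from \<open>x\<close> to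
    \<open>y\<close>.\<close>
  have old: "f y < f z + (e + s) * l2_dist d y z" if "z \<in> wall d l u" for z
  proof -
    have "f x < f z + e * l2_dist d x z" using T that by (simp add: trap_def)
    moreover have "f y + e * l2_dist d x y \<le> f x" using y_min[of x] by simp
    moreover have "e * l2_dist d x z \<le> e * l2_dist d x y + e * l2_dist d y z"
      using mult_left_mono[OF tri e, of z] by (simp add: algebra_simps)
    moreover have "0 \<le> s * l2_dist d y z" using s by simp
    ultimately show ?thesis by (simp add: algebra_simps)
  qed
  \<comment> \<open>On a cut, \<open>y\<close> competes with a net point near \<open>z\<close>. The
    loss is below \<open>s * w\<close>, and since \<open>z\<close> is at distance at least
    \<open>h \<ge> w\<close> from \<open>y\<close>, raising the tolerance by \<open>s\<close> pays
    for it.\<close>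
  have new: "f y < f z + (e + s) * l2_dist d y z"
    if z: "z \<in> box d l u" and cut: "z i \<in> cuts w (l i) (u i) (x i)" and yz: "\<bar>y i - z i\<bar> = h" for z
  proof -
    have D: "w \<le> l2_dist d x z"
      using cuts_dist[OF cut w] abs_le_l2_dist[OF i, of x z] by simp
    then have D0: "0 < l2_dist d x z" using w by simp
    obtain v where v: "v \<in> net d i n w x l u"
      "f v + e * l2_dist d x v \<le>
       f z + e * l2_dist d x z + real d * (16 * w / real n)\<^sup>2 * (1 + e / (2 * l2_dist d x z))"
      using net_approx[OF P z i cut n e width D0] by blast
    have "real d * (16 * w / real n)\<^sup>2 * (1 + e / (2 * l2_dist d x z))
        \<le> real d * (16 * w / real n)\<^sup>2 * (1 + e / (2 * w))"
      using e w D D0 by (intro mult_left_mono add_left_mono divide_left_mono) auto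
    then have "f y + e * l2_dist d x y < f z + e * l2_dist d x z + s * w"
      using v y_min[of v] err by simp
    moreover have "e * l2_dist d x z \<le> e * l2_dist d x y + e * l2_dist d y z"
      using mult_left_mono[OF tri e, of z] by (simp add: algebra_simps)
    moreover have "s * w \<le> s * l2_dist d y z"
      using s h0 yz abs_le_l2_dist[OF i, of y z] by (intro mult_left_mono) auto
    ultimately show ?thesis by (simp add: algebra_simps)
  qed
  \<comment> \<open>Both candidate faces sit at odd multiples of \<open>w\<close> from
    \<open>x\<close>: 1 and -1 if \<open>y = x\<close>, otherwise the neighbours
    \<open>k + 2\<close> and \<open>k - 2\<close>.\<close>
  have y_cut: "\<exists>k::int. odd k \<and> y i + \<sigma> * h = x i + of_int k * w" if \<sigma>: "\<sigma> = 1 \<or> \<sigma> = - 1" for \<sigma> :: real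
  proof (cases "y = x")
    case True
    then show ?thesis using \<sigma> by (intro exI[of _ "if \<sigma> = 1 then 1 else -1"]) (auto simp: h margin_def)
  next
    case False
    then have "y \<in> net d i n w x l u" using yQ by simp
    from PiE_mem[OF this[unfolded net_def], of i] obtain k :: int
      where k: "odd k" "y i = x i + of_int k * w" using i by (auto simp: cuts_def)
    show ?thesis using \<sigma> False k
      by (intro exI[of _ "if \<sigma> = 1 then k + 2 else k - 2"]) (auto simp: h margin_def algebra_simps)
  qed
  have xi: "l i \<le> x i" "x i \<le> u i" "l i \<le> y i" "y i \<le> u i"
    using xb yb i by (auto simp: box_def)
  show ?thesis
    unfolding trap_def
  proof (intro conjI ballI)
    show "pointed_box d y (lower i h y l) (upper i h y u)"
      using pointed_box_step[OF P yb] h0 w by simp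
    fix z assume z: "z \<in> wall d (lower i h y l) (upper i h y u)"
    then have zb: "z \<in> box d l u"
      using wall_subset_box box_step_subset by blast
    obtain j where j: "j < d" "z j = lower i h y l j \<and> lower i h y l j > 0 \<or>
        z j = upper i h y u j \<and> upper i h y u j < 1"
      using z by (auto simp: wall_def)
    show "f y < f z + (e + s) * l2_dist d y z"
    proof (cases "z \<in> wall d l u")
      case True
      then show ?thesis by (rule old)
    next
      case False
      then have nw: "\<not> (z j = l j \<and> l j > 0 \<or> z j = u j \<and> u j < 1)" using zb j(1) by (auto simp: wall_def)
      have ji: "j = i"
      proof (rule ccontr)
        assume "j \<noteq> i"
        then show False using j(2) nw by (simp add: lower_def upper_def)
      qed
      have zi: "l i \<le> z i" "z i \<le> u i" using zb i by (auto simp: box_def)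
      have "z i = max (l i) (y i - h) \<and> z i > 0 \<or> z i = min (u i) (y i + h) \<and> z i < 1"
        using j(2) by (metis ji lower_def upper_def fun_upd_same)
      \<comment> \<open>If the old bound were the active one in \<open>max\<close> or
        \<open>min\<close>, \<open>z\<close> would lie on an old wall, which \<open>nw\<close>
        excludes.\<close>
      then have "z i = y i - h \<and> l i < z i \<or> z i = y i + h \<and> z i < u i"
        using nw zi unfolding ji by linarith
      then obtain \<sigma> :: real where \<sigma>: "\<sigma> = 1 \<or> \<sigma> = - 1" "z i = y i + \<sigma> * h" "l i < z i" "z i < u i"
      proof
        assume "z i = y i - h \<and> l i < z i"
        then show thesis using that[of "-1"] xi h0 w by auto
      next
        assume "z i = y i + h \<and> z i < u i"
        then show thesis using that[of 1] xi h0 w by auto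
      qed
      obtain k :: int where k: "odd k" "z i = x i + of_int k * w" using y_cut[OF \<sigma>(1)] \<sigma>(2) by auto
      have "z i \<in> cuts w (l i) (u i) (x i)"
        by (rule cutsI[OF \<sigma>(3,4) k(2,1) w xi(1,2) width[OF i]])
      moreover have "\<bar>y i - z i\<bar> = h" using \<sigma> h0 w by auto
      ultimately show ?thesis by (rule new[OF zb])
    qed
  qed
qed

text \<open>Every wall point has a larger penalised value than \<open>x\<close>, so a minimiser over
  the compact box avoids the walls. A small ball around it, taken within the cube, stays in the box,
  and the triangle inequality recentres the penalty at \<open>p\<close>.\<close>

lemma trap_contains_local_min:
  assumes T: "trap d f e x l u" and e: "0 \<le> e"
  obtains p r where "p \<in> box d l u" "r > 0"
    "\<And>z. z \<in> unit_cube d \<Longrightarrow> l2_dist d p z < r \<Longrightarrow> f p \<le> f z + e * l2_dist d p z"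
proof -
  let ?F = "\<lambda>z. f z + e * l2_dist d x z"
  have P: "pointed_box d x l u" using T by (simp add: trap_def)
  have xb: "x \<in> box d l u" using P by (simp add: pointed_box_def)
  have "continuous_on (box d l u) ?F"
    by (intro continuous_intros continuous_on_l2_dist continuous_on_subset[OF continuous_on_cube])
      (auto simp: box_def)
  then obtain p where p: "p \<in> box d l u" "\<And>z. z \<in> box d l u \<Longrightarrow> ?F p \<le> ?F z"
    using continuous_attains_inf[OF compact_box, of d l u ?F] xb by blast
  have nw: "p \<notin> wall d l u"
  proof
    assume "p \<in> wall d l u"
    then have "f x < ?F p" using T by (simp add: trap_def)
    then show False using p(2)[OF xb] by simp
  qed
  \<comment> \<open>Distance to the walls in direction \<open>i\<close>; the default 1 stands for
    faces on the boundary of the cube.\<close>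
  define c where "c i = min (if l i > 0 then p i - l i else 1) (if u i < 1 then u i - p i else 1)" for i
  have "0 < c i" if "i < d" for i
  proof -
    have "l i \<le> p i" "p i \<le> u i" using p(1) that by (auto simp: box_def)
    moreover have "\<not> (p i = l i \<and> l i > 0 \<or> p i = u i \<and> u i < 1)"
      using nw wallI[OF p(1) that] by (rule contrapos_nn)
    ultimately show ?thesis by (auto simp: c_def)
  qed
  from finite_family_lower_bound[of d c, OF this]
  obtain r where r: "r > 0" "\<And>i. i < d \<Longrightarrow> r \<le> c i" by metis
  have "f p \<le> f z + e * l2_dist d p z" if z: "z \<in> unit_cube d" "l2_dist d p z < r" for z
  proof -
    have "l i \<le> z i \<and> z i \<le> u i" if i: "i < d" for i
    proof -
      have "\<bar>p i - z i\<bar> < r" using abs_le_l2_dist[OF i, of p z] z by simp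
      moreover have "0 \<le> z i" "z i \<le> 1" using z i by (auto simp: unit_cube_def PiE_iff)
      moreover have "l i > 0 \<Longrightarrow> r \<le> p i - l i" "u i < 1 \<Longrightarrow> r \<le> u i - p i"
        using r(2)[OF i] by (simp_all add: c_def)
      ultimately show ?thesis by (cases "l i > 0"; cases "u i < 1") linarith+
    qed
    then have "?F p \<le> ?F z" using z by (intro p(2)) (auto simp: box_def)
    moreover have "e * l2_dist d x z \<le> e * (l2_dist d x p + l2_dist d p z)"
      using e by (intro mult_left_mono l2_dist_triangle) auto
    ultimately show ?thesis by (simp add: algebra_simps)
  qed
  then show ?thesis by (rule that[OF p(1) r(1)])
qed

end

text \<open>
  A constrained stationary point on a face of the cube need not have stationary points nearby off that
  face, so the output is moved onto every face of the cube that the box touches.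
\<close>

definition snap :: "nat \<Rightarrow> point \<Rightarrow> point \<Rightarrow> point" where
  "snap d l u = (\<lambda>i\<in>{..<d}. if l i \<le> 0 then 0 else if u i \<ge> 1 then 1 else l i)"

lemma snap_in_box:
  assumes "pointed_box d x l u"
  shows "snap d l u \<in> box d l u"
proof -
  have *: "0 \<le> l i \<and> l i \<le> x i \<and> x i \<le> u i \<and> u i \<le> 1" if "i < d" for i
    using assms that by (auto simp: pointed_box_def box_def)
  have "l i \<le> snap d l u i \<and> snap d l u i \<le> u i \<and> 0 \<le> snap d l u i \<and> snap d l u i \<le> 1"
    if "i < d" for i
  proof -
    have "0 \<le> l i" "l i \<le> u i" "u i \<le> 1" using *[OF that] by auto
    then show ?thesis using that by (simp add: snap_def)
  qed
  moreover have "snap d l u \<in> extensional {..<d}" by (simp add: snap_def)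
  ultimately show ?thesis by (auto simp: box_def unit_cube_def PiE_iff)
qed

text \<open>The gradient at \<open>q\<close> is within \<open>real d * r\<close> of that at the
  minimiser \<open>p\<close>. As \<open>q\<close> lies on every cube face containing
  \<open>p\<close>, each direction \<open>y - q\<close> with \<open>y\<close> in the cube is
  feasible at \<open>p\<close>, where the first-order condition holds.\<close>

lemma (in smooth_function) stationary_snap:
  assumes T: "trap d f e x l u" and e: "0 \<le> e"
    and width: "\<And>i. i < d \<Longrightarrow> u i - l i \<le> r" and r: "r < 1" "e + real d * r \<le> \<epsilon>"
  shows "stationary_point d \<epsilon> f (snap d l u)"
proof -
  define q where "q = snap d l u"
  have P: "pointed_box d x l u" using T by (simp add: trap_def)
  have qb: "q \<in> box d l u" unfolding q_def by (rule snap_in_box[OF P])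
  then have qc: "q \<in> unit_cube d" by (simp add: box_def)
  obtain p r0 where p: "p \<in> box d l u" "r0 > 0"
    "\<And>z. z \<in> unit_cube d \<Longrightarrow> l2_dist d p z < r0 \<Longrightarrow> f p \<le> f z + e * l2_dist d p z"
    using trap_contains_local_min[OF T e] by blast
  then have pc: "p \<in> unit_cube d" by (simp add: box_def)
  have pb: "l i \<le> p i" "p i \<le> u i" "0 \<le> p i" "p i \<le> 1" "0 \<le> l i" "u i \<le> 1"
    "l i \<le> q i" "q i \<le> u i" if "i < d" for i
    using p(1) qb P that by (auto simp: box_def pointed_box_def unit_cube_def PiE_iff)
  have "\<bar>p i - q i\<bar> \<le> r" if "i < d" for i using pb[OF that] width[OF that] by linarith
  then have pq: "l2_dist d p q \<le> real d * r" by (rule l2_dist_le_bound)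
  define c where "c i = min (if p i > 0 then p i else 1) (if p i < 1 then 1 - p i else 1)" for i
  have "0 < c i" for i by (simp add: c_def)
  from finite_family_lower_bound[of d c, OF this]
  obtain t0 where t0: "t0 > 0" "\<And>i. i < d \<Longrightarrow> t0 \<le> c i" by metis
  show ?thesis unfolding q_def[symmetric]
  proof (rule stationary_pointI[OF qc])
    fix y assume y: "y \<in> unit_cube d"
    let ?v = "\<lambda>i. y i - q i"
    have seg: "seg d p ?v t \<in> unit_cube d" if t: "0 \<le> t" "t \<le> t0" for t
    proof -
      have "0 \<le> p i + t * ?v i \<and> p i + t * ?v i \<le> 1" if i: "i < d" for i
      proof -
        have yi: "0 \<le> y i" "y i \<le> 1" using y i by (auto simp: unit_cube_def PiE_iff)
        have v: "\<bar>?v i\<bar> \<le> 1" using yi pb[OF i] by linarith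
        have "\<bar>t * ?v i\<bar> \<le> t0"
          using mult_left_mono[OF v t(1)] t by (simp add: abs_mult)
        moreover have "p i = 0 \<Longrightarrow> 0 \<le> t * ?v i"
          using pb[OF i] yi t i by (auto simp: q_def snap_def)
        moreover have "t * ?v i \<le> 0" if "p i = 1"
        proof -
          \<comment> \<open>Since \<open>r < 1\<close>, the box cannot also touch the face at 0,
            which \<open>snap\<close> would prefer.\<close>
          have "q i = 1" using that pb[OF i] width[OF i] r i by (auto simp: q_def snap_def)
          then show ?thesis using yi t by (simp add: mult_le_0_iff)
        qed
        moreover have "p i > 0 \<Longrightarrow> t0 \<le> p i" "p i < 1 \<Longrightarrow> t0 \<le> 1 - p i"
          using t0(2)[OF i] by (simp_all add: c_def)
        ultimately show ?thesis
          using pb(3,4)[OF i] by (cases "p i = 0"; cases "p i = 1") (simp_all, linarith+)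
      qed
      then show ?thesis by (auto simp: unit_cube_def seg_def)
    qed
    have "- e * L2_set ?v {..<d} \<le> dot d (g p) ?v"
      by (rule directional_bound[OF pc t0(1) seg p(2,3)])
    moreover have "\<bar>dot d (g p) ?v - dot d (g q) ?v\<bar> \<le> l2_dist d p q * L2_set ?v {..<d}"
      by (rule dot_lip[OF pc qc])
    moreover have "(e + l2_dist d p q) * L2_set ?v {..<d} \<le> \<epsilon> * L2_set ?v {..<d}"
      using pq r by (intro mult_right_mono) auto
    ultimately show "- \<epsilon> * l2_dist d q y \<le> dot d (g q) ?v"
      by (simp add: L2_set_minus algebra_simps)
  qed
qed

section \<open>The algorithm\<close>

text \<open>\<open>t div d\<close> counts the complete sweeps, each dividing the side bound by
  4.\<close>

definition level :: "nat \<Rightarrow> nat \<Rightarrow> real" where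
  "level d t = (1/4) ^ (t div d)"

context
  fixes d :: nat and e :: "nat \<Rightarrow> real" and n :: "nat \<Rightarrow> nat"
begin

text \<open>Two counters: the \<open>k\<close> remaining rounds drive the recursion, the
  \<open>t\<close> completed ones select direction, scale and tolerance. The point \<open>x\<close>
  is queried anew each round, since only the current answers enter the comparison.\<close>

primrec flow_trap :: "nat \<Rightarrow> nat \<Rightarrow> point \<Rightarrow> point \<Rightarrow> point \<Rightarrow> algorithm" where
  "flow_trap 0 t x l u = Output (snap d l u)"
| "flow_trap (Suc k) t x l u =
    (let i = t mod d; w = level d t / 16; Q = insert x (net d i (n t) w x l u)
     in Round Q (\<lambda>a. let y = best d (e t) a x Q; h = margin w x y
          in flow_trap k (Suc t) y (lower i h y l) (upper i h y u)))"

end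

section \<open>Validity, depth, work and correctness of the decision tree\<close>

lemma level_pos: "0 < level d t"
  by (simp add: level_def)

lemma margin_pos: "w > 0 \<Longrightarrow> margin w x y > 0"
  by (simp add: margin_def)

text \<open>\<open>arg_min_on\<close> is a Hilbert choice, so equal results come from equality of
  the whole minimiser predicates; these inspect values on \<open>Q\<close> only.\<close>

lemma best_restrict: "best d e (restrict f Q) x Q = best d e f x Q"
proof -
  have "is_arg_min (\<lambda>v. restrict f Q v + e * l2_dist d x v) (\<lambda>v. v \<in> Q) =
      is_arg_min (\<lambda>v. f v + e * l2_dist d x v) (\<lambda>v. v \<in> Q)"
    by (rule ext) (auto simp: is_arg_min_def)
  then show ?thesis by (simp add: best_def arg_min_on_def arg_min_def)
qed

lemma valid_flow_trap:
  assumes "pointed_box d x l u"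
  shows "valid_algorithm d (flow_trap d e n k t x l u)"
  using assms
proof (induction k arbitrary: t x l u)
  case 0
  then show ?case using snap_in_box[OF 0] by (simp add: box_def)
next
  case (Suc k)
  define i w where "i = t mod d" and "w = level d t / 16"
  define Q where "Q = insert x (net d i (n t) w x l u)"
  have Q: "finite Q" "Q \<noteq> {}" by (auto simp: Q_def finite_net)
  have sub: "Q \<subseteq> box d l u" unfolding Q_def by (rule net_subset_box[OF Suc.prems])
  have "valid_algorithm d (flow_trap d e n k (Suc t) y
      (lower i (margin w x y) y l) (upper i (margin w x y) y u))"
    if "y \<in> Q" for y
  proof (rule Suc.IH, rule pointed_box_step[OF Suc.prems])
    show "y \<in> box d l u" using sub that by blast
    show "margin w x y > 0" by (simp add: margin_pos w_def level_pos)
  qed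
  then have "valid_algorithm d (flow_trap d e n k (Suc t) (best d (e t) a x Q)
      (lower i (margin w x (best d (e t) a x Q)) (best d (e t) a x Q) l)
      (upper i (margin w x (best d (e t) a x Q)) (best d (e t) a x Q) u))" for a
    using best(1)[OF Q] by blast
  moreover have "Q \<subseteq> unit_cube d" using sub by (auto simp: box_def)
  ultimately show ?case
    using Q(1) by (simp add: Let_def i_def[symmetric] w_def[symmetric] Q_def[symmetric])
qed

lemma depth_flow_trap: "alg_depth f (flow_trap d e n k t x l u) = k"
  by (induction k arbitrary: t x l u) (simp_all add: Let_def)

lemma work_flow_trap:
  assumes "d > 0"
  shows "alg_work f (flow_trap d e n k t x l u) \<le> (\<Sum>j<k. 34 * (n (t + j) + 1) ^ (d - 1))"
proof (induction k arbitrary: t x l u)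
  case (Suc k)
  define i w where "i = t mod d" and "w = level d t / 16"
  define Q where "Q = insert x (net d i (n t) w x l u)"
  define y where "y = best d (e t) (restrict f Q) x Q"
  have "card Q \<le> Suc (card (net d i (n t) w x l u))"
    unfolding Q_def by (rule card_insert_le_m1) (simp_all add: finite_net)
  \<comment> \<open>At most 33 cuts, and one query for \<open>x\<close>.\<close>
  also have "\<dots> \<le> 1 + 33 * (n t + 1) ^ (d - 1)"
    using card_net[of i d] assms by (simp add: i_def)
  also have "\<dots> \<le> 34 * (n t + 1) ^ (d - 1)" using one_le_power[of "n t + 1" "d - 1"] by simp
  finally have "card Q \<le> 34 * (n t + 1) ^ (d - 1)" .
  moreover have "alg_work f (flow_trap d e n (Suc k) t x l u) =
      card Q + alg_work f (flow_trap d e n k (Suc t) y (lower i (margin w x y) y l) (upper i (margin w x y) y u))"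
    by (simp add: Let_def i_def[symmetric] w_def[symmetric] Q_def[symmetric] y_def)
  ultimately show ?case
    using Suc.IH[of "Suc t" y "lower i (margin w x y) y l" "upper i (margin w x y) y u"]
    unfolding sum.lessThan_Suc_shift by simp
qed simp

text \<open>Invariant: directions \<open>j < t mod d\<close> have already been cut in the current
  sweep, so their side bound is one power of 4 smaller. With \<open>w = level d t / 16\<close>, the
  term \<open>8 * e t / level d t\<close> is \<open>e t / (2 * w)\<close>.\<close>

lemma (in smooth_function) flow_trap_correct:
  assumes d: "d > 0" and M: "M > 0"
    and n: "\<And>t. n t > 0" and e: "\<And>t. 0 \<le> e t" "\<And>t. e (Suc t) = e t + s"
    and err: "\<And>t. t < d * M \<Longrightarrow>
      real d * (level d t / real (n t))\<^sup>2 * (1 + 8 * e t / level d t) < s * level d t / 16"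
    and final: "e (d * M) + real d * (1/4) ^ M \<le> \<epsilon>"
    and tk: "t + k = d * M"
    and T: "trap d f (e t) x l u"
    and width: "\<And>j. j < d \<Longrightarrow> u j - l j \<le> (1/4) ^ (t div d + (if j < t mod d then 1 else 0))"
  shows "stationary_point d \<epsilon> f (alg_output f (flow_trap d e n k t x l u))"
  using tk T width
proof (induction k arbitrary: t x l u)
  case 0
  then have t: "t = d * M" by simp
  have "(1/4::real) ^ M \<le> 1/4" using power_decreasing[of 1 M "1/4::real"] M by simp
  then have "(1/4::real) ^ M < 1" by simp
  moreover have "u j - l j \<le> (1/4) ^ M" if "j < d" for j using 0(3)[OF that] d by (simp add: t)
  ultimately show ?case using stationary_snap[OF 0(2) e(1), of "(1/4) ^ M" \<epsilon>] final by (simp add: t)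
next
  case (Suc k)
  define i w where "i = t mod d" and "w = level d t / 16"
  define Q where "Q = insert x (net d i (n t) w x l u)"
  define y where "y = best d (e t) f x Q"
  define h where "h = margin w x y"
  have w: "w > 0" by (simp add: w_def level_pos)
  have i: "i < d" using d by (simp add: i_def)
  have wd: "u j - l j \<le> 16 * w" if "j < d" for j
  proof -
    have "(1/4::real) ^ (t div d + (if j < t mod d then 1 else 0)) \<le> (1/4) ^ (t div d)"
      by (rule power_decreasing) auto
    from order_trans[OF Suc.prems(3)[OF that] this] show ?thesis by (simp add: w_def level_def)
  qed
  have "real d * (16 * w / real (n t))\<^sup>2 * (1 + e t / (2 * w)) < s * w"
    using err[of t] Suc.prems(1) by (simp add: w_def ac_simps)
  from trap_step[OF Suc.prems(2) i n e(1) w wd this, of y h]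
  have T': "trap d f (e (Suc t)) y (lower i h y l) (upper i h y u)"
    by (simp add: e(2) y_def Q_def h_def)
  have "upper i h y u j - lower i h y l j \<le> (1/4) ^ (Suc t div d + (if j < Suc t mod d then 1 else 0))"
    if j: "j < d" for j
  proof -
    have old: "upper i h y u j - lower i h y l j \<le> u j - l j"
    proof (cases "j = i")
      case True
      then show ?thesis by (simp add: lower_def upper_def)
    qed (simp add: lower_def upper_def)
    have "upper i h y u i - lower i h y l i \<le> 2 * h" unfolding lower_def upper_def fun_upd_same by linarith
    also have "\<dots> \<le> 4 * w" using w by (simp add: h_def margin_def)
    also have "\<dots> = (1/4) ^ Suc (t div d)" by (simp add: w_def level_def)
    finally have new: "upper i h y u i - lower i h y l i \<le> (1/4) ^ Suc (t div d)" .
    \<comment> \<open>Cutting the last direction ends the sweep: \<open>t div d\<close> grows by one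
      and absorbs the bonus of every direction.\<close>
    have "Suc t div d + (if j < Suc t mod d then 1 else 0) =
        t div d + (if j \<le> t mod d then 1 else 0)"
      using j d by (auto simp: div_Suc mod_Suc)
    then show ?thesis
      using old new Suc.prems(3)[OF j] by (cases "j = i") (auto simp: i_def)
  qed
  then have "stationary_point d \<epsilon> f
      (alg_output f (flow_trap d e n k (Suc t) y (lower i h y l) (upper i h y u)))"
    using Suc.prems(1) by (intro Suc.IH T') auto
  then show ?case
    by (simp add: Let_def i_def[symmetric] w_def[symmetric] Q_def[symmetric] best_restrict
        y_def[symmetric] h_def[symmetric])
qed

text \<open>As \<open>d - 1 \<ge> 1\<close>, each term is at most \<open>(1/2) ^ (t div d)\<close>.
  Every exponent occurs \<open>d\<close> times, leaving a geometric series and hence a bound free of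
  \<open>M\<close>.\<close>

lemma sum_level_le:
  assumes "d \<ge> 2"
  shows "(\<Sum>t<d * M. sqrt (level d t) ^ (d - 1)) \<le> 2 * real d"
proof -
  have root: "sqrt (level d t) = (1/2) ^ (t div d)" for t
  proof -
    have "((1/2::real) ^ (t div d))\<^sup>2 = ((1/2)\<^sup>2) ^ (t div d)"
      by (simp only: power_mult[symmetric] mult.commute)
    also have "\<dots> = level d t" by (simp add: level_def power2_eq_square)
    finally show ?thesis using real_sqrt_unique by fastforce
  qed
  have "(\<Sum>t<d * M. sqrt (level d t) ^ (d - 1)) \<le> (\<Sum>t<M * d. (1/2) ^ (t div d))"
    unfolding root
  proof (rule order_trans[OF sum_mono])
    fix t
    show "((1/2::real) ^ (t div d)) ^ (d - 1) \<le> (1/2) ^ (t div d)"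
      using power_decreasing[of 1 "d - 1" "(1/2::real) ^ (t div d)"] assms by (simp add: power_le_one)
  qed (simp add: mult.commute)
  also have "\<dots> = (\<Sum>m<M. \<Sum>t = m * d..<m * d + d. (1/2) ^ (t div d))"
    by (rule sum.nat_group[symmetric])
  also have "\<dots> = (\<Sum>m<M. \<Sum>t = m * d..<m * d + d. (1/2) ^ m)"
  proof (intro sum.cong refl)
    fix m t assume "t \<in> {m * d..<m * d + d}"
    then have "t div d = m" using assms by (intro div_nat_eqI) (auto simp: mult.commute)
    then show "(1/2::real) ^ (t div d) = (1/2) ^ m" by simp
  qed
  also have "\<dots> = real d * (\<Sum>m<M. (1/2) ^ m)" by (simp add: sum_distrib_left)
  also have "\<dots> \<le> real d * 2"
  proof (rule mult_left_mono)
    have "(\<Sum>m<M. (1/2::real) ^ m) = 2 - 2 * (1/2) ^ M" by (induction M) auto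
    then show "(\<Sum>m<M. (1/2::real) ^ m) \<le> 2" by simp
  qed simp
  finally show ?thesis by (simp add: mult.commute)
qed

text \<open>\<open>M\<close> is the least number of quarterings bringing the side to at most
  \<open>\<epsilon> / (2 * real d)\<close>, so that the final snap costs at most
  \<open>\<epsilon> / 2\<close>. Minimality bounds \<open>M\<close> logarithmically; the last bound
  trades \<open>ln (real d)\<close> for a factor \<open>real d\<close>, harmless in the
  work.\<close>

lemma obtain_levels:
  assumes d: "d \<ge> 2" and \<epsilon>: "0 < \<epsilon>" "\<epsilon> \<le> 1/2"
  obtains M where "M > 0" "(1/4) ^ M \<le> \<epsilon> / (2 * real d)"
    "\<And>m. m < M \<Longrightarrow> \<epsilon> / (2 * real d) < (1/4) ^ m"
    "real M \<le> 3 * ln (real d / \<epsilon>)" "real M \<le> 9 * real d * ln (1 / \<epsilon>)"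
proof -
  define c where "c = \<epsilon> / (2 * real d)"
  have c: "0 < c" using d \<epsilon> by (simp add: c_def)
  have c1: "c < 1" using d \<epsilon> by (simp add: c_def pos_divide_less_eq)
  define M where "M = (LEAST m. (1/4::real) ^ m \<le> c)"
  have "\<exists>m. (1/4::real) ^ m < c" by (rule real_arch_pow_inv[OF c]) simp
  then have "\<exists>m. (1/4::real) ^ m \<le> c" using less_imp_le by blast
  then have le: "(1/4) ^ M \<le> c" unfolding M_def by (rule LeastI_ex)
  have gt: "c < (1/4) ^ m" if "m < M" for m
    using not_less_Least[OF that[unfolded M_def]] by (simp only: not_le)
  have M: "M > 0"
  proof (rule ccontr)
    assume "\<not> M > 0"
    then show False using le c1 by simp
  qed
  have ln4: "1 \<le> ln (4::real)" using exp_le by (simp add: ln_ge_iff)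
  have ln2: "1/2 \<le> ln (2::real)"
    using ln4 ln_realpow[of "2::real" 2] by simp
  have pos: "0 < real d / \<epsilon>" using d \<epsilon> by simp
  have "inverse ((1/4) ^ (M - 1)) < inverse c"
    using gt[of "M - 1"] M c by (intro less_imp_inverse_less) auto
  moreover have "inverse ((1/4) ^ (M - 1)) = (4::real) ^ (M - 1)"
    by (simp only: power_inverse[symmetric]) simp
  moreover have "inverse c = 2 * (real d / \<epsilon>)" by (simp add: c_def)
  ultimately have "(4::real) ^ (M - 1) < 2 * (real d / \<epsilon>)" by simp
  then have "ln ((4::real) ^ (M - 1)) < ln (2 * (real d / \<epsilon>))"
    using pos by (intro ln_strict_mono) auto
  moreover have "ln ((4::real) ^ (M - 1)) = real (M - 1) * ln 4" by (rule ln_realpow)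
  moreover have "ln (2 * (real d / \<epsilon>)) = ln 2 + ln (real d / \<epsilon>)"
    using pos by (intro ln_mult_pos) auto
  ultimately have "real (M - 1) * ln 4 < ln 2 + ln (real d / \<epsilon>)" by linarith
  moreover have "real (M - 1) * 1 \<le> real (M - 1) * ln 4" using ln4 by (intro mult_left_mono) auto
  moreover have "ln (2::real) < 1" by (rule ln_2_less_1)
  \<comment> \<open>The logarithm is at least \<open>ln 4 \<ge> 1\<close>, which absorbs the
    additive constants in \<open>M < 2 + ln (real d / \<epsilon>)\<close>.\<close>
  moreover have "4 \<le> real d / \<epsilon>" using d \<epsilon> by (simp add: field_simps)
  then have "ln 4 \<le> ln (real d / \<epsilon>)" by (subst ln_le_cancel_iff) auto
  ultimately have M3: "real M \<le> 3 * ln (real d / \<epsilon>)" using ln4 M by (simp add: of_nat_diff)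
  define L where "L = ln (1 / \<epsilon>)"
  \<comment> \<open>\<open>L \<ge> 1/2\<close> gives \<open>2 * real d * L \<ge> real d\<close>,
    which absorbs \<open>ln (real d)\<close>.\<close>
  have "ln 2 \<le> L" unfolding L_def using \<epsilon> by (subst ln_le_cancel_iff) (auto simp: field_simps)
  then have L: "1/2 \<le> L" using ln2 by simp
  have "ln (real d / \<epsilon>) = ln (real d) + L" using d \<epsilon> by (simp add: L_def ln_div)
  moreover have "ln (real d) \<le> real d - 1" using d by (intro ln_le_minus_one) auto
  moreover have "real d * (1/2) \<le> real d * L" using L by (intro mult_left_mono) auto
  moreover have "1 * L \<le> real d * L" using L d by (intro mult_right_mono) auto
  ultimately have "ln (real d / \<epsilon>) \<le> 3 * (real d * L)" by linarith
  then have "real M \<le> 9 * real d * L" using M3 by simp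
  then show thesis using that[OF M] le gt M3 by (simp add: c_def L_def)
qed

section \<open>Complexity\<close>

text \<open>As \<open>r\<close> exceeds \<open>\<epsilon> / (2 * real d)\<close>, the factor
  \<open>1 + 8 * e / r\<close> is at most \<open>9 * real d\<close>. The constant 25 then suffices
  because \<open>9 * 64 = 576 < 625 = 25 * 25\<close>.\<close>

lemma cut_error_bound:
  fixes d M n :: nat and r e \<epsilon> :: real
  assumes d: "d > 0" and M: "M > 0" and \<epsilon>: "0 < \<epsilon>" and r: "\<epsilon> < 2 * real d * r"
    and n: "n > 0" "25 * sqrt (real d ^ 3 * real M * r / \<epsilon>) \<le> real n"
    and e: "0 \<le> e" "e \<le> \<epsilon> / 2"
  shows "real d * (r / real n)\<^sup>2 * (1 + 8 * e / r) < \<epsilon> / (4 * real d * real M) * r / 16"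
proof -
  define \<delta> where "\<delta> = real d"
  have \<delta>: "1 \<le> \<delta>" using d by (simp add: \<delta>_def)
  have "0 < 2 * \<delta> * r" using r \<epsilon> unfolding \<delta>_def by linarith
  then have r0: "0 < r" using \<delta> by (simp add: zero_less_mult_iff)
  define q where "q = \<delta> ^ 3 * real M * r / \<epsilon>"
  have q: "0 < q" using \<delta> M r0 \<epsilon> by (simp add: q_def)
  have "(25 * sqrt q)\<^sup>2 \<le> (real n)\<^sup>2" using n q by (intro power_mono) (simp_all add: q_def \<delta>_def)
  then have n2: "625 * q \<le> (real n)\<^sup>2" using q by (simp add: power_mult_distrib)
  have "8 * e / r \<le> 4 * (2 * \<delta> * r) / r"
    using e r r0 by (intro divide_right_mono) (auto simp: \<delta>_def)
  then have "1 + 8 * e / r \<le> 9 * \<delta>" using r0 \<delta> by simp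
  then have "\<delta> * (r / real n)\<^sup>2 * (1 + 8 * e / r) \<le> \<delta> * (r / real n)\<^sup>2 * (9 * \<delta>)"
    using \<delta> by (intro mult_left_mono) auto
  also have "\<dots> = 9 * \<delta>\<^sup>2 * r\<^sup>2 / (real n)\<^sup>2" by (simp add: power_divide power2_eq_square)
  also have "\<dots> \<le> 9 * \<delta>\<^sup>2 * r\<^sup>2 / (625 * q)"
    using n2 q n(1) by (intro divide_left_mono) auto
  also have "\<dots> = 9 / 625 * (\<epsilon> * r / (\<delta> * real M))"
    using \<delta> r0 \<epsilon> M by (simp add: q_def field_simps power2_eq_square power3_eq_cube)
  also have "\<dots> < 1 / 64 * (\<epsilon> * r / (\<delta> * real M))"
    using \<delta> r0 \<epsilon> M by (intro mult_strict_right_mono) auto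
  also have "\<dots> = \<epsilon> / (4 * \<delta> * real M) * r / 16" by simp
  finally show ?thesis by (simp add: \<delta>_def)
qed

text \<open>Both 68 and 81 are below \<open>2 ^ 7\<close>, hence below \<open>real d ^ 7\<close>;
  the total exponent is \<open>8 + 9 * (d - 1) = 9 * d - 1\<close>.\<close>

lemma dimension_factor_bound:
  assumes "d \<ge> (2::nat)"
  shows "68 * real d * (81 * (real d)\<^sup>2) ^ (d - 1) \<le> real d powr (9 * real d)"
proof -
  have d: "(2::real) \<le> real d" using assms by simp
  have "(128::real) = 2 ^ 7" by simp
  also have "\<dots> \<le> real d ^ 7" using d by (intro power_mono) auto
  finally have 128: "(128::real) \<le> real d ^ 7" .
  have "68 * real d * (81 * (real d)\<^sup>2) ^ (d - 1) \<le> real d ^ 7 * real d * (real d ^ 7 * (real d)\<^sup>2) ^ (d - 1)"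
    using 128 by (intro mult_mono power_mono) auto
  also have "\<dots> = real d ^ (8 + 9 * (d - 1))"
    by (simp add: power_add power_mult flip: power_Suc2)
  also have "\<dots> \<le> real d ^ (9 * d)"
    using d assms by (intro power_increasing) auto
  also have "\<dots> = real d powr (9 * real d)"
    using d by (subst powr_realpow[symmetric]) auto
  finally show ?thesis .
qed

text \<open>\<open>K\<close> collects what does not depend on the round, so each mesh size is of
  order \<open>sqrt (K * level d t)\<close>. \<open>sum_level_le\<close> adds up the rounds, and
  \<open>M9\<close> turns \<open>K\<close> into \<open>Y\<close> up to powers of
  \<open>d\<close>.\<close>

lemma work_bound:
  fixes n :: "nat \<Rightarrow> nat"
  assumes d: "d \<ge> 2" and M: "M > 0" and \<epsilon>: "0 < \<epsilon>" "\<epsilon> \<le> 1/2"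
    and level: "\<And>t. t < d * M \<Longrightarrow> \<epsilon> < 2 * real d * level d t"
    and n: "\<And>t. real (n t) \<le> 25 * sqrt (real d ^ 3 * real M * level d t / \<epsilon>) + 1"
    and M9: "real M \<le> 9 * real d * ln (1 / \<epsilon>)"
  shows "real (\<Sum>t<d * M. 34 * (n t + 1) ^ (d - 1)) \<le>
    real d powr (9 * real d) * (ln (1 / \<epsilon>) / \<epsilon>) powr ((real d - 1) / 2)"
proof -
  define K where "K = real d ^ 3 * real M / \<epsilon>"
  define Y where "Y = ln (1 / \<epsilon>) / \<epsilon>"
  have K: "0 \<le> K" using \<epsilon> by (simp add: K_def)
  have Y: "0 < Y" using \<epsilon> by (simp add: Y_def)
  have d2: "2 \<le> real d" using d by simp
  have "K \<le> real d ^ 3 * (9 * real d * ln (1 / \<epsilon>)) / \<epsilon>"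
    unfolding K_def using M9 \<epsilon> by (intro divide_right_mono mult_left_mono) auto
  also have "\<dots> = (3 * (real d)\<^sup>2)\<^sup>2 * Y"
    by (simp add: Y_def power2_eq_square power3_eq_cube)
  finally have "sqrt K \<le> sqrt ((3 * (real d)\<^sup>2)\<^sup>2 * Y)" by (rule real_sqrt_le_mono)
  also have "\<dots> = 3 * (real d)\<^sup>2 * sqrt Y"
    unfolding real_sqrt_mult real_sqrt_abs by simp
  finally have sK: "sqrt K \<le> 3 * (real d)\<^sup>2 * sqrt Y" .
  have term_le: "real (34 * (n t + 1) ^ (d - 1)) \<le> 34 * (27 * sqrt K) ^ (d - 1) * sqrt (level d t) ^ (d - 1)"
    if t: "t < d * M" for t
  proof -
    define Z where "Z = real d ^ 3 * real M * level d t / \<epsilon>"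
    \<comment> \<open>\<open>Z \<ge> 1\<close> absorbs two additive ones, from rounding up and from
      counting both mesh endpoints, so 25 becomes 27.\<close>
    have "2 * 2 \<le> real d * real d" using d2 by (intro mult_mono) auto
    moreover have "1 \<le> real M" using M by simp
    moreover have "1 / 2 \<le> real d * level d t / \<epsilon>" using level[OF t] \<epsilon> by (simp add: field_simps)
    ultimately have "2 * 2 * 1 * (1/2) \<le> real d * real d * real M * (real d * level d t / \<epsilon>)"
      using d by (intro mult_mono) auto
    then have "1 \<le> Z" by (simp add: Z_def power3_eq_cube mult.assoc mult.left_commute)
    then have "1 \<le> sqrt Z" by simp
    then have "real (n t + 1) \<le> 27 * sqrt Z" 
      using n[of t, folded Z_def] unfolding of_nat_add of_nat_1 by linarith
    also have "Z = K * level d t" by (simp add: Z_def K_def)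
    finally have "real (n t + 1) \<le> 27 * sqrt K * sqrt (level d t)" by (simp add: real_sqrt_mult)
    then have "real (n t + 1) ^ (d - 1) \<le> (27 * sqrt K * sqrt (level d t)) ^ (d - 1)"
      by (rule power_mono) simp
    then show ?thesis by (simp add: power_mult_distrib)
  qed
  have "real (\<Sum>t<d * M. 34 * (n t + 1) ^ (d - 1))
      \<le> (\<Sum>t<d * M. 34 * (27 * sqrt K) ^ (d - 1) * sqrt (level d t) ^ (d - 1))"
    unfolding of_nat_sum by (rule sum_mono) (rule term_le, simp)
  also have "\<dots> = 34 * (27 * sqrt K) ^ (d - 1) * (\<Sum>t<d * M. sqrt (level d t) ^ (d - 1))"
    by (rule sum_distrib_left[symmetric])
  also have "\<dots> \<le> 34 * (27 * sqrt K) ^ (d - 1) * (2 * real d)"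
    using K by (intro mult_left_mono sum_level_le[OF d]) auto
  also have "\<dots> \<le> 34 * (27 * (3 * (real d)\<^sup>2 * sqrt Y)) ^ (d - 1) * (2 * real d)"
    using sK K by (intro mult_right_mono mult_left_mono power_mono) auto
  also have "\<dots> = 68 * real d * (81 * (real d)\<^sup>2) ^ (d - 1) * sqrt Y ^ (d - 1)"
  proof -
    have "27 * (3 * (real d)\<^sup>2 * sqrt Y) = 81 * (real d)\<^sup>2 * sqrt Y" by simp
    then show ?thesis by (simp only: power_mult_distrib[of "81 * (real d)\<^sup>2"]) simp
  qed
  also have "\<dots> \<le> real d powr (9 * real d) * sqrt Y ^ (d - 1)"
    using Y by (intro mult_right_mono dimension_factor_bound[OF d]) auto
  also have "sqrt Y ^ (d - 1) = Y powr ((real d - 1) / 2)"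
  proof -
    have "sqrt Y ^ (d - 1) = (Y powr (1/2)) powr real (d - 1)"
      using Y by (simp add: powr_half_sqrt powr_realpow)
    also have "\<dots> = Y powr ((real d - 1) / 2)" using d by (simp add: powr_powr of_nat_diff)
    finally show ?thesis .
  qed
  finally show ?thesis by (simp add: Y_def)
qed

text \<open>All faces lie on the boundary of the cube, so there are no walls and any tolerance is
  allowed.\<close>

lemma trap_cube:
  shows "trap d f e (\<lambda>i\<in>{..<d}. 0) (\<lambda>_. 0) (\<lambda>_. 1)"
  by (auto simp: trap_def wall_def pointed_box_def box_def unit_cube_def)

theorem theorem2:
  shows "\<exists>C::real. C > 0 \<and>
    (\<forall>(d::nat) (\<epsilon>::real). d \<ge> 2 \<and> 0 < \<epsilon> \<and> \<epsilon> \<le> 1/2 \<longrightarrow>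
      (\<exists>A. valid_algorithm d A \<and>
        (\<forall>f. smooth_on_cube d f \<longrightarrow>
           stationary_point d \<epsilon> f (alg_output f A) \<and>
           real (alg_depth f A) \<le> C * (real d)\<^sup>2 * ln (real d / \<epsilon>) \<and>
           real (alg_work f A) \<le>
             real d powr (C * real d) * (ln (1 / \<epsilon>) / \<epsilon>) powr ((real d - 1) / 2))))"
proof (rule exI[of _ 9], intro conjI allI impI)
  \<comment> \<open>The 9 is dictated by the exponent \<open>9 * real d\<close> of the dimension
    factor.\<close>
  show "(9::real) > 0" by simp
  fix d :: nat and \<epsilon> :: real
  assume "d \<ge> 2 \<and> 0 < \<epsilon> \<and> \<epsilon> \<le> 1/2"
  then have d: "d \<ge> 2" and \<epsilon>: "0 < \<epsilon>" "\<epsilon> \<le> 1/2" by auto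
  obtain M where M: "M > 0" and final: "(1/4) ^ M \<le> \<epsilon> / (2 * real d)"
    and small: "\<And>m. m < M \<Longrightarrow> \<epsilon> / (2 * real d) < (1/4) ^ m"
    and M3: "real M \<le> 3 * ln (real d / \<epsilon>)" and M9: "real M \<le> 9 * real d * ln (1 / \<epsilon>)"
    using obtain_levels[OF d \<epsilon>] by metis
  \<comment> \<open>The \<open>d * M\<close> increases add up to \<open>\<epsilon> / 4\<close> and
    take the tolerance from \<open>\<epsilon> / 4\<close> to \<open>\<epsilon> / 2\<close>; the
    other half is left for the final snap.\<close>
  define s where "s = \<epsilon> / (4 * real d * real M)"
  define e where "e t = \<epsilon> / 4 + s * real t" for t
  define n where "n t = nat \<lceil>25 * sqrt (real d ^ 3 * real M * level d t / \<epsilon>)\<rceil>" for t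
  define x where "x = (\<lambda>i\<in>{..<d}. 0 :: real)"
  define A where "A = flow_trap d e n (d * M) 0 x (\<lambda>_. 0) (\<lambda>_. 1)"
  have d0: "d > 0" using d by simp
  have s: "0 < s" using \<epsilon> d0 M by (simp add: s_def)
  have e0: "0 \<le> e t" for t using \<epsilon> s by (simp add: e_def)
  have e_Suc: "e (Suc t) = e t + s" for t by (simp add: e_def algebra_simps)
  have e_end: "e (d * M) = \<epsilon> / 2" using d0 M by (simp add: e_def s_def)
  have e_le: "e t \<le> \<epsilon> / 2" if "t < d * M" for t
  proof -
    have "s * real t \<le> s * real (d * M)" using that s by (intro mult_left_mono) (auto simp del: of_nat_mult)
    then show ?thesis using e_end by (simp add: e_def)
  qed
  have "0 < 25 * sqrt (real d ^ 3 * real M * level d t / \<epsilon>)" for t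
    using d0 M \<epsilon> level_pos[of d t] by simp
  then have n: "n t > 0" "25 * sqrt (real d ^ 3 * real M * level d t / \<epsilon>) \<le> real (n t)"
    "real (n t) \<le> 25 * sqrt (real d ^ 3 * real M * level d t / \<epsilon>) + 1" for t
    unfolding n_def by (smt (verit) zero_less_ceiling zero_less_nat_eq, linarith,
        smt (verit) of_nat_nat zero_less_ceiling ceiling_correct)
  have level: "\<epsilon> < 2 * real d * level d t" if "t < d * M" for t
  proof -
    have "t div d < M" using that by (simp add: less_mult_imp_div_less mult.commute)
    from small[OF this] show ?thesis using d0 by (simp add: level_def field_simps)
  qed
  have T: "trap d f e' x (\<lambda>_. 0) (\<lambda>_. 1)" for f e' unfolding x_def by (rule trap_cube)
  show "\<exists>A. valid_algorithm d A \<and>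
        (\<forall>f. smooth_on_cube d f \<longrightarrow>
           stationary_point d \<epsilon> f (alg_output f A) \<and>
           real (alg_depth f A) \<le> 9 * (real d)\<^sup>2 * ln (real d / \<epsilon>) \<and>
           real (alg_work f A) \<le>
             real d powr (9 * real d) * (ln (1 / \<epsilon>) / \<epsilon>) powr ((real d - 1) / 2))"
  proof (intro exI[of _ A] conjI allI impI)
    show "valid_algorithm d A"
      unfolding A_def by (rule valid_flow_trap) (use T in \<open>simp add: trap_def\<close>)
    fix f assume "smooth_on_cube d f"
    then obtain g where "smooth_function d f g"
      unfolding smooth_on_cube_def smooth_function_def by blast
    then interpret smooth_function d f g .
    show "stationary_point d \<epsilon> f (alg_output f A)"
      unfolding A_def
    proof (rule flow_trap_correct[where e = e and s = s, OF d0 M n(1) e0 e_Suc])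
      show "real d * (level d t / real (n t))\<^sup>2 * (1 + 8 * e t / level d t) < s * level d t / 16"
        if "t < d * M" for t
        unfolding s_def by (rule cut_error_bound[OF d0 M \<epsilon>(1) level[OF that] n(1,2) e0 e_le[OF that]])
      have "real d * (1/4) ^ M \<le> real d * (\<epsilon> / (2 * real d))"
        using final by (rule mult_left_mono) simp
      then show "e (d * M) + real d * (1/4) ^ M \<le> \<epsilon>" using d0 by (simp add: e_end)
      show "trap d f (e 0) x (\<lambda>_. 0) (\<lambda>_. 1)" by (rule T)
    qed simp_all
    have "real (d * M) \<le> real d * (3 * ln (real d / \<epsilon>))"
      using M3 by (simp add: mult_left_mono)
    also have "\<dots> \<le> (9 * (real d)\<^sup>2) * ln (real d / \<epsilon>)"
    proof -
      have "1 \<le> real d / \<epsilon>" using d \<epsilon> by (simp add: field_simps)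
      then have "0 \<le> ln (real d / \<epsilon>)" by simp
      moreover have "real d * 3 \<le> 9 * (real d)\<^sup>2"
        using d by (simp add: power2_eq_square)
      ultimately show ?thesis unfolding mult.assoc[symmetric] by (intro mult_right_mono)
    qed
    finally show "real (alg_depth f A) \<le> 9 * (real d)\<^sup>2 * ln (real d / \<epsilon>)"
      by (simp add: A_def depth_flow_trap)
    have "real (alg_work f A) \<le> real (\<Sum>t<d * M. 34 * (n t + 1) ^ (d - 1))"
      unfolding A_def of_nat_le_iff using work_flow_trap[OF d0, of f e n "d * M" 0] by simp
    also have "\<dots> \<le> real d powr (9 * real d) * (ln (1 / \<epsilon>) / \<epsilon>) powr ((real d - 1) / 2)"
      by (rule work_bound[OF d M \<epsilon> level n(3) M9])
    finally show "real (alg_work f A) \<le>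
        real d powr (9 * real d) * (ln (1 / \<epsilon>) / \<epsilon>) powr ((real d - 1) / 2)" .
  qed
qed

end
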